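(* Let $r\ge 1$ and $n_1,\ldots,n_r\ge 1$ be integers, $n=\sum_{i=1}^r n_i$. Let $\alpha_{i,j}$ ($1\le i\le r$, $1\le j\le n_i$), $b_1,\ldots,b_r$ and $d_1,\ldots,d_{r-1}$ be nonnegative integers such that $\alpha_{i,j}\ge b_i$ for all $i,j$, $b_1\ge d_1$, $b_i\ge d_{i-1}$ for $2\le i\le r$, and $d_i\ge d_{i+1}$ for $1\le i\le r-2$. Let $H$ be the symmetric $n\times n$ matrix whose rows and columns are indexed by the pairs $(i,u)$ with $1\le i\le r$, $1\le u\le n_i$ (ordered lexicographically), with entries \[ H_{(i,u),(i,u)}=\alpha_{i,u},\qquad H_{(i,u),(i,v)}=b_i\ (u\neq v),\qquad H_{(i,u),(j,v)}=d_{\max(i,j)-1}\ (i\neq j). \] That is, $H$ has diagonal blocks $H_i$ (the $n_i\times n_i$ matrix with diagonal $\alpha_{i,1},\ldots,\alpha_{i,n_i}$ and all off-diagonal entries $b_i$), and the off-diagonal block in block position $(i,j)$, $i\ne j$, has all entries equal to $d_{\max(i,j)-1}$. Then $\dim_{\mathbb{K}}(R_n/\mathcal{J}_H)=\det H$.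
   Context: $\mathbb{K}$ is a field and $R_n$ is the polynomial ring over $\mathbb{K}$ in $n$ variables, one variable $x_{i,u}$ for each row index $(i,u)$ of $H$. For a symmetric matrix $H=[h_{p,q}]$ of nonnegative integers indexed by a set $I$ of size $n$ with $h_{p,p}\ge\max_{q\ne p}h_{p,q}$, write $\alpha_p=h_{p,p}$ and define the monomial ideal $\mathcal{J}_H=\left\langle x_p^{\alpha_p},\ x_p^{\alpha_p-h_{p,q}}x_q^{\alpha_q-h_{p,q}}\mid p\in I,\ p\neq q\in I\right\rangle\subseteq R_n$. *)

theory Defs
  imports
    "HOL-Library.Poly_Mapping"
    "HOL-Algebra.QuotRing"
    "Jordan_Normal_Form.Determinant"
    "Jordan_Normal_Form.VS_Connect"
begin

text \<open>
  A monomial is a finitely supported exponent vector \<open>'v \<Rightarrow>\<^sub>0 nat\<close>; the type below, with its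
  convolution product from Poly_Mapping, is the polynomial ring in all variables of type \<open>'v\<close>.
  The ring in the variables from a set \<open>I\<close> is the subring \<open>mpoly_ring I\<close>.
\<close>

type_synonym ('v, 'k) mpoly = "('v \<Rightarrow>\<^sub>0 nat) \<Rightarrow>\<^sub>0 'k"

definition var :: "'v \<Rightarrow> ('v, 'k::field) mpoly" where
  "var p = Poly_Mapping.single (Poly_Mapping.single p 1) 1"

definition const :: "'k \<Rightarrow> ('v, 'k::field) mpoly" where
  "const c = Poly_Mapping.single 0 c"

definition mpoly_ring :: "'v set \<Rightarrow> ('v, 'k::field) mpoly ring" where
  "mpoly_ring I =
     \<lparr> carrier = {f. \<forall>m \<in> Poly_Mapping.keys f. Poly_Mapping.keys m \<subseteq> I},
       mult = (*), one = 1, zero = 0, add = (+) \<rparr>"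

text \<open>
  The natural-number subtractions are genuine subtractions as long as
  \<open>h p q \<le> h p p\<close> and \<open>h p q = h q p\<close> for all \<open>p\<close>, \<open>q\<close> in \<open>I\<close>.
\<close>

definition ideal_J :: "'v set \<Rightarrow> ('v \<Rightarrow> 'v \<Rightarrow> nat) \<Rightarrow> ('v, 'k::field) mpoly set" where
  "ideal_J I h = Idl\<^bsub>mpoly_ring I\<^esub>
     ({var p ^ h p p | p. p \<in> I} \<union>
      {var p ^ (h p p - h p q) * var q ^ (h q q - h p q) | p q. p \<in> I \<and> q \<in> I \<and> p \<noteq> q})"

text \<open>
  The quotient ring by \<open>J\<close> as a vector space over \<open>'k\<close>: a scalar acts by multiplication with the
  class of the corresponding constant polynomial.
\<close>

definition quotient_space ::
    "'v set \<Rightarrow> ('v, 'k::field) mpoly set \<Rightarrow> ('k, ('v, 'k) mpoly set) module" where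
  "quotient_space I J =
     (let Q = mpoly_ring I Quot J in
      \<lparr> carrier = carrier Q, mult = mult Q, one = one Q, zero = zero Q, add = add Q,
        smult = (\<lambda>c X. (J +>\<^bsub>mpoly_ring I\<^esub> const c) \<otimes>\<^bsub>Q\<^esub> X) \<rparr>)"

lemma keys_times_subset:
  fixes f g :: "('v, 'k::field) mpoly"
  assumes "m \<in> Poly_Mapping.keys (f * g)"
    "\<forall>m \<in> Poly_Mapping.keys f. Poly_Mapping.keys m \<subseteq> I"
    "\<forall>m \<in> Poly_Mapping.keys g. Poly_Mapping.keys m \<subseteq> I"
  shows "Poly_Mapping.keys m \<subseteq> I"
proof -
  from assms(1) keys_mult[of f g] obtain a b
    where "m = a + b" "a \<in> Poly_Mapping.keys f" "b \<in> Poly_Mapping.keys g"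
    by blast
  with assms(2,3) Poly_Mapping.keys_add[of a b] show ?thesis by blast
qed

lemma cring_mpoly_ring: "cring (mpoly_ring I :: ('v, 'k::field) mpoly ring)"
proof (rule cringI)
  show "abelian_group (mpoly_ring I :: ('v, 'k) mpoly ring)"
  proof (rule abelian_groupI)
    fix x y :: "('v, 'k) mpoly"
    assume *: "x \<in> carrier (mpoly_ring I)" "y \<in> carrier (mpoly_ring I)"
    then show "x \<oplus>\<^bsub>mpoly_ring I\<^esub> y \<in> carrier (mpoly_ring I)"
      using Poly_Mapping.keys_add[of x y] by (fastforce simp: mpoly_ring_def)
    have "- x \<in> carrier (mpoly_ring I)" using * by (simp add: mpoly_ring_def)
    then show "\<exists>y \<in> carrier (mpoly_ring I). y \<oplus>\<^bsub>mpoly_ring I\<^esub> x = \<zero>\<^bsub>mpoly_ring I\<^esub>"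
      by (rule bexI[rotated]) (simp add: mpoly_ring_def)
  qed (auto simp: mpoly_ring_def add.assoc add.commute)
  show "comm_monoid (mpoly_ring I :: ('v, 'k) mpoly ring)"
  proof (rule comm_monoidI)
    fix x y :: "('v, 'k) mpoly"
    assume "x \<in> carrier (mpoly_ring I)" "y \<in> carrier (mpoly_ring I)"
    then show "x \<otimes>\<^bsub>mpoly_ring I\<^esub> y \<in> carrier (mpoly_ring I)"
      using keys_times_subset[of _ x y I] by (auto simp: mpoly_ring_def)
  qed (auto simp: mpoly_ring_def mult.assoc mult.commute)
qed (auto simp: mpoly_ring_def algebra_simps)

lemma const_ring_hom: "const \<in> Ring.ring_hom class_ring (mpoly_ring I)"
  by (rule ring_hom_memI)
    (auto simp: mpoly_ring_def const_def mult_single single_add)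

lemma var_closed: "p \<in> I \<Longrightarrow> var p \<in> carrier (mpoly_ring I)"
  by (auto simp: mpoly_ring_def var_def)

lemma vectorspace_quotient_space:
  fixes J :: "('v, 'k::field) mpoly set"
  assumes "ideal J (mpoly_ring I)"
  shows "vectorspace class_ring (quotient_space I J)"
proof -
  let ?R = "mpoly_ring I :: ('v, 'k) mpoly ring"
  let ?V = "quotient_space I J"
  interpret J: ideal J ?R by fact
  interpret Q: cring "?R Quot J"
    by (rule J.quotient_is_cring) (rule cring_mpoly_ring)
  define s where "s = (\<lambda>c. J +>\<^bsub>?R\<^esub> const c)"
  have s: "s \<in> Ring.ring_hom class_ring (?R Quot J)"
    using ring_hom_trans[OF const_ring_hom J.rcos_ring_hom] by (simp add: s_def comp_def)
  have [simp]: "carrier ?V = carrier (?R Quot J)" "zero ?V = zero (?R Quot J)"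
    "add ?V = add (?R Quot J)" "smult ?V = (\<lambda>c X. s c \<otimes>\<^bsub>?R Quot J\<^esub> X)"
    by (simp_all add: quotient_space_def Let_def s_def)
  have s_closed [simp]: "s c \<in> carrier (?R Quot J)" for c
    using ring_hom_closed[OF s, of c] by simp
  have s_add: "s (c + c') = s c \<oplus>\<^bsub>?R Quot J\<^esub> s c'" for c c'
    using ring_hom_add[OF s, of c c'] by simp
  have s_mult: "s (c * c') = s c \<otimes>\<^bsub>?R Quot J\<^esub> s c'" for c c'
    using ring_hom_mult[OF s, of c c'] by simp
  have s_one: "s 1 = \<one>\<^bsub>?R Quot J\<^esub>"
    using ring_hom_one[OF s] by simp
  have "abelian_group ?V"
    by (rule abelian_groupI)
      (auto simp: Q.a_ac intro: Q.a_inv_closed Q.l_neg bexI[of _ "\<ominus>\<^bsub>?R Quot J\<^esub> _"])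
  moreover have "cring (class_ring :: 'k ring)"
    by (rule field.axioms(1)[OF class_field, THEN domain.axioms(1)])
  ultimately have "Module.module class_ring ?V"
    by (intro Module.module.intro Module.module_axioms.intro)
      (auto simp: s_add s_mult s_one Q.l_distr Q.r_distr Q.m_assoc)
  then show ?thesis
    using class_field by (rule vectorspace.intro)
qed

text \<open>The pairs \<open>(i, u)\<close> with \<open>1 \<le> i \<le> r\<close>, \<open>1 \<le> u \<le> n i\<close>, in lexicographic order.\<close>

definition index_list :: "nat \<Rightarrow> (nat \<Rightarrow> nat) \<Rightarrow> (nat \<times> nat) list" where
  "index_list r n = concat (map (\<lambda>i. map (Pair i) [1..<n i + 1]) [1..<r + 1])"

definition index_set :: "nat \<Rightarrow> (nat \<Rightarrow> nat) \<Rightarrow> (nat \<times> nat) set" where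
  "index_set r n = {(i, u). 1 \<le> i \<and> i \<le> r \<and> 1 \<le> u \<and> u \<le> n i}"

lemma set_index_list: "set (index_list r n) = index_set r n"
  by (auto simp: index_list_def index_set_def image_iff simp del: upt_Suc)

lemma length_index_list: "length (index_list r n) = (\<Sum>i = 1..r. n i)"
proof -
  have "length (index_list r n) = sum_list (map n [1..<r + 1])"
    by (simp add: index_list_def length_concat comp_def del: upt_Suc)
  also have "\<dots> = (\<Sum>i = 1..r. n i)"
    by (subst sum_list_distinct_conv_sum_set)
      (simp_all del: upt_Suc add: atLeastLessThanSuc_atLeastAtMost)
  finally show ?thesis .
qed

lemma distinct_index_list: "distinct (index_list r n)"
proof (rule card_distinct)
  have "set (index_list r n) = (SIGMA i:{1..r}. {1..n i})"
    by (auto simp: set_index_list index_set_def)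
  then show "card (set (index_list r n)) = length (index_list r n)"
    by (simp add: length_index_list)
qed

fun H_entry ::
    "(nat \<Rightarrow> nat \<Rightarrow> nat) \<Rightarrow> (nat \<Rightarrow> nat) \<Rightarrow> (nat \<Rightarrow> nat) \<Rightarrow> nat \<times> nat \<Rightarrow> nat \<times> nat \<Rightarrow> nat" where
  "H_entry \<alpha> b d (i, u) (j, v) =
     (if i = j then (if u = v then \<alpha> i u else b i) else d (max i j - 1))"

text \<open>
  The row of index \<open>(i, u)\<close> of the matrix sits at the (0-based) position of \<open>(i, u)\<close> in
  \<open>index_list\<close>.
\<close>

definition H_matrix ::
    "nat \<Rightarrow> (nat \<Rightarrow> nat) \<Rightarrow> (nat \<Rightarrow> nat \<Rightarrow> nat) \<Rightarrow> (nat \<Rightarrow> nat) \<Rightarrow> (nat \<Rightarrow> nat) \<Rightarrow> int mat" where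
  "H_matrix r n \<alpha> b d =
     mat (\<Sum>i = 1..r. n i) (\<Sum>i = 1..r. n i)
       (\<lambda>(k, l). int (H_entry \<alpha> b d (index_list r n ! k) (index_list r n ! l)))"

end

theory Submission
  imports Defs
begin

text \<open>
  A monomial \<open>m\<close> outside \<open>J\<close> is recorded by \<open>a p = \<alpha> p - 1
  - m p\<close>; then \<open>m \<notin> J\<close> means \<open>0 \<le> a p < \<alpha> p\<close>
  and \<open>max (a p) (a q) \<ge> h p q\<close> for \<open>p \<noteq> q\<close>, and the
  dimension of the quotient is the number of such \<open>a\<close>. The hypotheses on
  \<open>b\<close> and \<open>d\<close> enter only through the ultrametric inequality \<open>min
  (h p q) (h q s) \<le> h p s\<close>, and the number of such \<open>a\<close> is the determinant
  for every symmetric \<open>h\<close> with this property. Indeed, if some positive diagonal entry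
  \<open>h p p\<close> exceeds all other entries of its row, lowering it by one decreases both the
  determinant and the count by their value for the index set without \<open>p\<close>. If no
  diagonal entry of a matrix of size at least two can be lowered, choose an off-diagonal entry
  \<open>h p q\<close> of maximal value: then \<open>h p p = h q q = h p q\<close>, the
  ultrametric inequality makes the rows \<open>p\<close> and \<open>q\<close> equal, and both
  numbers vanish.
\<close>

section \<open>Determinants of ultrametric matrices\<close>

text \<open>An arbitrary list of indices keeps the family of matrices closed under deleting one row
  together with the same column.\<close>

definition list_mat :: "('v \<Rightarrow> 'v \<Rightarrow> nat) \<Rightarrow> 'v list \<Rightarrow> int mat" where
  "list_mat h xs = mat (length xs) (length xs) (\<lambda>(k, l). int (h (xs ! k) (xs ! l)))"

text \<open>\<open>PiE\<close> pins the values outside \<open>S\<close>, so the cardinality counts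
  vectors indexed by \<open>S\<close>.\<close>

definition admissible :: "('v \<Rightarrow> 'v \<Rightarrow> nat) \<Rightarrow> 'v set \<Rightarrow> ('v \<Rightarrow> nat) set" where
  "admissible h S =
     {a \<in> PiE S (\<lambda>p. {..<h p p}). \<forall>p\<in>S. \<forall>q\<in>S. p \<noteq> q \<longrightarrow> h p q \<le> max (a p) (a q)}"

text \<open>The case \<open>s = p\<close> of the inequality says that diagonal entries dominate their rows.\<close>

definition ultrametric_on :: "'v set \<Rightarrow> ('v \<Rightarrow> 'v \<Rightarrow> nat) \<Rightarrow> bool" where
  "ultrametric_on S h \<longleftrightarrow>
     (\<forall>p\<in>S. \<forall>q\<in>S. h p q = h q p) \<and> (\<forall>p\<in>S. \<forall>q\<in>S. \<forall>s\<in>S. min (h p q) (h q s) \<le> h p s)"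

definition lower_diag :: "'v \<Rightarrow> ('v \<Rightarrow> 'v \<Rightarrow> nat) \<Rightarrow> 'v \<Rightarrow> 'v \<Rightarrow> nat" where
  "lower_diag p h = h(p := (h p)(p := h p p - 1))"

lemma lower_diag_apply:
  "lower_diag p h x y = (if x = p \<and> y = p then h p p - 1 else h x y)"
  by (simp add: lower_diag_def)

lemma finite_admissible: "finite S \<Longrightarrow> finite (admissible h S)"
  unfolding admissible_def by (rule finite_subset[OF _ finite_PiE[of S "\<lambda>p. {..<h p p}"]]) auto

lemma list_mat_carrier [simp]: "list_mat h xs \<in> carrier_mat (length xs) (length xs)"
  by (simp add: list_mat_def)

lemma ultrametric_onD:
  assumes "ultrametric_on S h" "p \<in> S" "q \<in> S"
  shows "h p q = h q p" and "s \<in> S \<Longrightarrow> min (h p q) (h q s) \<le> h p s" and "h p q \<le> h p p"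
  using assms unfolding ultrametric_on_def by (blast, blast, metis min.idem)

lemma ultrametric_on_subset: "ultrametric_on S h \<Longrightarrow> T \<subseteq> S \<Longrightarrow> ultrametric_on T h"
  unfolding ultrametric_on_def by blast

text \<open>Lowering an entry on the left of an ultrametric inequality only weakens it. The lowered
  entry stands on the right only in \<open>min (h p y) (h y p) \<le> h p p - 1\<close>: for
  \<open>y \<noteq> p\<close> this is strict dominance, and for \<open>y = p\<close> the left side
  is lowered too.\<close>

lemma ultrametric_on_lower_diag:
  assumes u: "ultrametric_on S h" and p: "p \<in> S" and lt: "\<And>q. q \<in> S \<Longrightarrow> q \<noteq> p \<Longrightarrow> h p q < h p p"
  shows "ultrametric_on S (lower_diag p h)"
proof -
  have "min (lower_diag p h x y) (lower_diag p h y z) \<le> lower_diag p h x z"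
    if "x \<in> S" "y \<in> S" "z \<in> S" for x y z
    using ultrametric_onD(2)[OF u that(1,2,3)] lt[of y] lt[of z] ultrametric_onD(1)[OF u that(1,2)] that
    by (auto simp: lower_diag_apply)
  moreover have "lower_diag p h x y = lower_diag p h y x" if "x \<in> S" "y \<in> S" for x y
    using ultrametric_onD(1)[OF u that] by (auto simp: lower_diag_apply)
  ultimately show ?thesis unfolding ultrametric_on_def by blast
qed

section \<open>Effect of lowering one diagonal entry on the count and on the determinant\<close>

text \<open>The vectors are split by whether \<open>a p\<close> takes its largest value
  \<open>h p p - 1\<close>. If it does, strict dominance satisfies every constraint involving
  \<open>p\<close>, and the rest of \<open>a\<close> is any admissible vector on
  \<open>S - {p}\<close>. If not, \<open>a\<close> is admissible for the lowered matrix.\<close>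

lemma card_admissible_lower_diag:
  assumes fin: "finite S" and u: "ultrametric_on S h" and p: "p \<in> S" and pos: "0 < h p p"
    and lt: "\<And>q. q \<in> S \<Longrightarrow> q \<noteq> p \<Longrightarrow> h p q < h p p"
  shows "card (admissible h S) =
    card (admissible (lower_diag p h) S) + card (admissible h (S - {p}))"
proof -
  let ?g = "\<lambda>a. a(p := h p p - 1)"
  have lt': "h q p < h p p" if "q \<in> S" "q \<noteq> p" for q
    using lt[OF that] ultrametric_onD(1)[OF u that(1) p] by simp
  have split: "admissible h S = admissible (lower_diag p h) S \<union> ?g ` admissible h (S - {p})"
  proof (intro equalityI subsetI)
    fix a assume a: "a \<in> admissible h S"
    show "a \<in> admissible (lower_diag p h) S \<union> ?g ` admissible h (S - {p})"
    proof (cases "a p = h p p - 1")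
      case True
      \<comment> \<open>Resetting the value at \<open>p\<close> to \<open>undefined\<close> is the
        restriction to \<open>S - {p}\<close> in the \<open>PiE\<close> encoding.\<close>
      have "a(p := undefined) \<in> admissible h (S - {p})"
        using a p by (auto simp: admissible_def PiE_def extensional_def)
      moreover have "a = ?g (a(p := undefined))" using True by auto
      ultimately show ?thesis by blast
    next
      case False
      then have "a p < h p p - 1" using a p by (force simp: admissible_def)
      then have "a \<in> admissible (lower_diag p h) S"
        using a by (auto simp: admissible_def lower_diag_apply PiE_def Pi_def)
      then show ?thesis by blast
    qed
  next
    fix a assume "a \<in> admissible (lower_diag p h) S \<union> ?g ` admissible h (S - {p})"
    then show "a \<in> admissible h S"
    proof
      assume a: "a \<in> admissible (lower_diag p h) S"
      have "a q < h q q" if "q \<in> S" for q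
        using a that by (force simp: admissible_def lower_diag_apply split: if_splits)
      moreover have "h q s \<le> max (a q) (a s)" if "q \<in> S" "s \<in> S" "q \<noteq> s" for q s
        using a that unfolding admissible_def lower_diag_apply by (smt (verit) mem_Collect_eq)
      ultimately show ?thesis using a by (auto simp: admissible_def PiE_def)
    next
      assume "a \<in> ?g ` admissible h (S - {p})"
      then obtain c where c: "c \<in> admissible h (S - {p})" "a = ?g c" by blast
      have "h q s \<le> max (a q) (a s)" if "q \<in> S" "s \<in> S" "q \<noteq> s" for q s
        using c that lt[of s] lt'[of q] by (auto simp: admissible_def)
      moreover have "a \<in> PiE S (\<lambda>p. {..<h p p})"
        using c p pos by (auto simp: admissible_def PiE_def extensional_def Pi_def)
      ultimately show ?thesis by (simp add: admissible_def)
    qed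
  qed
  have inj: "inj_on ?g (admissible h (S - {p}))"
  proof (rule inj_onI)
    fix c c' assume c: "c \<in> admissible h (S - {p})" "c' \<in> admissible h (S - {p})" and eq: "?g c = ?g c'"
    \<comment> \<open>The value overwritten by \<open>?g\<close> is always the same, so nothing is
      lost.\<close>
    have "c p = undefined" "c' p = undefined"
      using c by (auto simp: admissible_def PiE_def extensional_def)
    then show "c = c'" using eq by (metis fun_upd_triv fun_upd_upd)
  qed
  have "a p < h p p - 1" if "a \<in> admissible (lower_diag p h) S" for a
    using that p by (force simp: admissible_def lower_diag_apply)
  then have "admissible (lower_diag p h) S \<inter> ?g ` admissible h (S - {p}) = {}" by force
  then show ?thesis
    unfolding split using fin card_image[OF inj]
    by (subst card_Un_disjoint) (simp_all add: finite_admissible)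
qed

text \<open>Both determinants are expanded along row \<open>k\<close>. The matrices differ only at
  \<open>(k, k)\<close>, so the cofactors of that row agree, and the difference is the cofactor at
  \<open>(k, k)\<close>, a principal minor with sign \<open>+1\<close>.\<close>

lemma det_list_mat_lower_diag:
  assumes k: "k < length xs" and dist: "distinct xs" and pos: "0 < h (xs ! k) (xs ! k)"
  shows "det (list_mat h xs) =
    det (list_mat (lower_diag (xs ! k) h) xs) + det (list_mat h (take k xs @ drop (Suc k) xs))"
proof -
  let ?A = "list_mat h xs" and ?B = "list_mat (lower_diag (xs ! k) h) xs"
  have eq: "xs ! i = xs ! k \<longleftrightarrow> i = k" if "i < length xs" for i
    using that k dist by (simp add: nth_eq_iff_index_eq)
  have row: "mat_delete ?A k j = mat_delete ?B k j" for j
    using k by (intro eq_matI) (auto simp: list_mat_def mat_delete_def lower_diag_apply eq)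
  \<comment> \<open>Positivity of the entry makes the natural-number subtraction in
    \<open>lower_diag\<close> a decrease by exactly one.\<close>
  have AB: "?A $$ (k, j) = ?B $$ (k, j) + (if j = k then 1 else 0)" if "j < length xs" for j
    using that k pos by (auto simp: list_mat_def lower_diag_apply eq)
  have "mat_delete ?A k k = list_mat h (take k xs @ drop (Suc k) xs)"
    using k by (intro eq_matI) (auto simp: list_mat_def mat_delete_def nth_append)
  then have cof: "cofactor ?A k k = det (list_mat h (take k xs @ drop (Suc k) xs))"
    by (simp add: Determinant.cofactor_def)
  have "det ?A = (\<Sum>j<length xs. ?A $$ (k, j) * cofactor ?A k j)"
    using k by (intro laplace_expansion_row) auto
  also have "\<dots> = (\<Sum>j<length xs. ?B $$ (k, j) * cofactor ?B k j
      + (if j = k then cofactor ?A k j else 0))"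
    by (intro sum.cong refl) (auto simp: AB Determinant.cofactor_def row algebra_simps)
  also have "\<dots> = det ?B + cofactor ?A k k"
    using k by (subst laplace_expansion_row[of ?B "length xs" k]) (auto simp: sum.distrib)
  finally show ?thesis by (simp add: cof)
qed

section \<open>Matrices in which no diagonal entry can be lowered\<close>

text \<open>Both \<open>a p\<close> and \<open>a q\<close> would lie below \<open>h p q\<close>,
  against the constraint for this pair.\<close>

lemma admissible_empty_if_diag_eq:
  assumes "p \<in> S" "q \<in> S" "p \<noteq> q" "h p p = h p q" "h q q = h p q"
  shows "admissible h S = {}"
proof -
  have False if "a \<in> admissible h S" for a
  proof -
    have "a p < h p q" "a q < h p q"
      using that assms by (force simp: admissible_def)+
    moreover have "h p q \<le> max (a p) (a q)" using that assms by (auto simp: admissible_def)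
    ultimately show False by simp
  qed
  then show ?thesis by blast
qed

text \<open>The pair is one where the off-diagonal entry is largest; \<open>crit\<close> then bounds
  every diagonal entry by the same value.\<close>

lemma obtain_critical_pair:
  assumes fin: "finite S" and u: "ultrametric_on S h" and two: "x \<in> S" "y \<in> S" "x \<noteq> y"
    and crit: "\<And>p. p \<in> S \<Longrightarrow> 0 < h p p \<Longrightarrow> \<exists>q\<in>S. q \<noteq> p \<and> h p p \<le> h p q"
  obtains p q where "p \<in> S" "q \<in> S" "p \<noteq> q" "h p p = h p q" "h q q = h p q"
    "\<forall>s\<in>S. h p s = h q s"
proof -
  define P where "P = {(p, q). p \<in> S \<and> q \<in> S \<and> p \<noteq> q}"
  have "finite P" unfolding P_def by (rule finite_subset[of _ "S \<times> S"]) (use fin in auto)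
  moreover have "P \<noteq> {}" using two by (auto simp: P_def)
  ultimately have "Max (case_prod h ` P) \<in> case_prod h ` P" by simp
  then obtain z where z: "z \<in> P" "case_prod h z = Max (case_prod h ` P)" by force
  obtain p q where pq: "z = (p, q)" by force
  have p: "p \<in> S" and q: "q \<in> S" and ne: "p \<noteq> q" using z(1) pq by (auto simp: P_def)
  have max: "h s t \<le> h p q" if "s \<in> S" "t \<in> S" "s \<noteq> t" for s t
  proof -
    have "(s, t) \<in> P" using that by (simp add: P_def)
    then have "case_prod h (s, t) \<le> Max (case_prod h ` P)" using \<open>finite P\<close> by (intro Max_ge) auto
    then show ?thesis using z(2) pq by simp
  qed
  have diag: "h s s \<le> h p q" if s: "s \<in> S" for s
  proof (cases "h s s = 0")
    case False
    then show ?thesis using crit[OF s] max[OF s] by fastforce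
  qed simp
  have sym: "h p q = h q p" using ultrametric_onD(1)[OF u p q] .
  have pp: "h p p = h p q" using diag[OF p] ultrametric_onD(3)[OF u p q] by simp
  have qq: "h q q = h p q" using diag[OF q] ultrametric_onD(3)[OF u q p] sym by simp
  have "h p s = h q s" if s: "s \<in> S" for s
  proof -
    \<comment> \<open>Since \<open>h p q\<close> bounds both entries, the minima in the two
      ultrametric inequalities reduce to \<open>h q s \<le> h p s\<close> and
      \<open>h p s \<le> h q s\<close>.\<close>
    have "h p s \<le> h p q" "h q s \<le> h p q"
      using max[OF p s] max[OF q s] pp qq by (metis order_refl)+
    then show ?thesis
      using ultrametric_onD(2)[OF u p q s] ultrametric_onD(2)[OF u q p s] sym by simp
  qed
  with p q ne pp qq show ?thesis using that by blast
qed

text \<open>The induction measure adds the size to the sum of the diagonal: lowering an entry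
  decreases the sum, and deleting an index decreases the size without increasing the sum.\<close>

lemma det_ultrametric_eq_card_admissible:
  assumes "distinct xs" and "ultrametric_on (set xs) h"
  shows "det (list_mat h xs) = int (card (admissible h (set xs)))"
  using assms
proof (induction "length xs + (\<Sum>p\<in>set xs. h p p)" arbitrary: h xs rule: less_induct)
  case less
  let ?S = "set xs"
  note dist = less.prems(1) and u = less.prems(2)
  \<comment> \<open>In size one, strict dominance is vacuous, so a positive entry falls under
    \<open>step\<close> and only the zero matrix is left for \<open>single\<close>.\<close>
  consider (nil) "xs = []"
    | (step) p where "p \<in> ?S" "0 < h p p" "\<And>q. q \<in> ?S \<Longrightarrow> q \<noteq> p \<Longrightarrow> h p q < h p p"
    | (single) x where "xs = [x]" "h x x = 0"
    | (crit) x y where "x \<in> ?S" "y \<in> ?S" "x \<noteq> y"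
        "\<And>p. p \<in> ?S \<Longrightarrow> 0 < h p p \<Longrightarrow> \<exists>q\<in>?S. q \<noteq> p \<and> h p p \<le> h p q"
  proof (cases xs)
    case Nil
    then show ?thesis using that(1) by blast
  next
    case (Cons x ys)
    show ?thesis
    proof (cases "\<exists>p\<in>?S. 0 < h p p \<and> (\<forall>q\<in>?S. q \<noteq> p \<longrightarrow> h p q < h p p)")
      case True
      then show ?thesis using that(2) by blast
    next
      case no: False
      show ?thesis
      proof (cases ys)
        case Nil
        then show ?thesis using no Cons that(3) by auto
      next
        case (Cons y zs)
        then have "x \<in> ?S" "y \<in> ?S" "x \<noteq> y" using \<open>xs = x # ys\<close> dist by auto
        then show ?thesis using no that(4) by (meson not_less)
      qed
    qed
  qed
  then show ?case
  proof cases
    case nil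
    \<comment> \<open>The empty determinant is 1, and there is exactly one function in
      \<open>PiE\<close> over the empty set.\<close>
    then show ?thesis by (simp add: list_mat_def admissible_def)
  next
    case (step p)
    obtain k where k: "k < length xs" "xs ! k = p" using step(1) by (auto simp: in_set_conv_nth)
    define ys where "ys = take k xs @ drop (Suc k) xs"
    have xs: "xs = take k xs @ p # drop (Suc k) xs" using id_take_nth_drop[OF k(1)] k(2) by simp
    have p_notin: "p \<notin> set ys" and set_xs: "?S = insert p (set ys)" and dys: "distinct ys"
    proof -
      have "distinct (take k xs @ p # drop (Suc k) xs)" using dist by (subst (asm) xs)
      then show "p \<notin> set ys" "distinct ys" by (auto simp: ys_def)
      have "?S = set (take k xs @ p # drop (Suc k) xs)" by (subst xs) (rule refl)
      then show "?S = insert p (set ys)" by (simp add: ys_def)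
    qed
    have set_ys: "set ys = ?S - {p}" using p_notin set_xs by auto
    have len: "length xs = Suc (length ys)" using k by (simp add: ys_def)
    have sum_diag: "(\<Sum>q\<in>?S. f q) = f p + (\<Sum>q\<in>set ys. f q)" for f :: "_ \<Rightarrow> nat"
      using p_notin by (simp add: set_xs)
    have "(\<Sum>q\<in>set ys. lower_diag p h q q) = (\<Sum>q\<in>set ys. h q q)"
      using p_notin by (intro sum.cong) (auto simp: lower_diag_apply)
    then have smaller: "(\<Sum>q\<in>?S. lower_diag p h q q) < (\<Sum>q\<in>?S. h q q)"
      using step(2) unfolding sum_diag by (simp add: lower_diag_apply)
    have "det (list_mat h xs) = det (list_mat (lower_diag p h) xs) + det (list_mat h ys)"
      using det_list_mat_lower_diag[of k xs h] k dist step(2) by (simp add: ys_def)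
    also have "det (list_mat (lower_diag p h) xs) = int (card (admissible (lower_diag p h) ?S))"
      using smaller ultrametric_on_lower_diag[OF u step(1,3)] dist
      by (intro less.hyps) simp_all
    also have "det (list_mat h ys) = int (card (admissible h (set ys)))"
      using dys ultrametric_on_subset[OF u, of "set ys"] set_ys
      by (intro less.hyps) (auto simp: sum_diag len)
    finally show ?thesis
      using card_admissible_lower_diag[OF _ u step(1,2,3)] by (simp add: set_ys)
  next
    case (single x)
    have "list_mat h [x] \<in> carrier_mat 1 1" using list_mat_carrier[of h "[x]"] by simp
    then have "det (list_mat h [x]) = list_mat h [x] $$ (0, 0)" by (rule det_single)
    then have "det (list_mat h xs) = 0" using single by (simp add: list_mat_def)
    moreover have "admissible h ?S = {}"
      using single by (simp add: admissible_def PiE_def Pi_def)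
    ultimately show ?thesis by simp
  next
    case (crit x y)
    obtain p q where pq: "p \<in> ?S" "q \<in> ?S" "p \<noteq> q" "h p p = h p q" "h q q = h p q"
      and rows: "\<forall>s\<in>?S. h p s = h q s"
      by (rule obtain_critical_pair[OF finite_set u crit])
    obtain k l where kl: "k < length xs" "xs ! k = p" "l < length xs" "xs ! l = q"
      using pq by (meson in_set_conv_nth)
    have "row (list_mat h xs) k = row (list_mat h xs) l"
      using kl rows by (intro eq_vecI) (auto simp: list_mat_def)
    then have "det (list_mat h xs) = 0"
      using kl pq(3) by (intro det_identical_rows[of _ "length xs" k l]) auto
    then show ?thesis using admissible_empty_if_diag_eq[OF pq] by simp
  qed
qed

section \<open>Quotients by monomial ideals\<close>

lemma poly_mapping_eq_sum_single:
  assumes "finite A" "Poly_Mapping.keys f \<subseteq> A"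
  shows "f = (\<Sum>m\<in>A. Poly_Mapping.single m (Poly_Mapping.lookup f m))"
proof (rule poly_mapping_eqI)
  fix k
  have "Poly_Mapping.lookup (\<Sum>m\<in>A. Poly_Mapping.single m (Poly_Mapping.lookup f m)) k =
      (\<Sum>m\<in>A. if m = k then Poly_Mapping.lookup f m else 0)"
    by (simp add: lookup_sum lookup_single when_def)
  also have "\<dots> = Poly_Mapping.lookup f k"
    using assms by (auto simp: in_keys_iff)
  finally show "Poly_Mapping.lookup f k =
      Poly_Mapping.lookup (\<Sum>m\<in>A. Poly_Mapping.single m (Poly_Mapping.lookup f m)) k" ..
qed

lemma mpoly_ring_simps [simp]:
  "carrier (mpoly_ring I) = {f. \<forall>m \<in> Poly_Mapping.keys f. Poly_Mapping.keys m \<subseteq> I}"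
  "mult (mpoly_ring I) = (*)" "one (mpoly_ring I) = 1" "zero (mpoly_ring I) = 0"
  "add (mpoly_ring I) = (+)"
  by (simp_all add: mpoly_ring_def)

lemma a_inv_mpoly_ring:
  fixes f :: "('v, 'k::field) mpoly"
  assumes "f \<in> carrier (mpoly_ring I)"
  shows "\<ominus>\<^bsub>mpoly_ring I\<^esub> f = - f"
proof -
  interpret R: cring "mpoly_ring I :: ('v, 'k) mpoly ring" by (rule cring_mpoly_ring)
  show ?thesis using assms by (intro R.minus_equality) auto
qed

lemma a_minus_mpoly_ring:
  fixes f g :: "('v, 'k::field) mpoly"
  assumes "g \<in> carrier (mpoly_ring I)"
  shows "f \<ominus>\<^bsub>mpoly_ring I\<^esub> g = f - g"
  using a_inv_mpoly_ring[OF assms] by (simp add: a_minus_def)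

text \<open>Each exponent of a product is a sum of exponents of the factors, so upward closure of
  \<open>U\<close> gives absorption.\<close>

lemma ideal_keys_subset:
  fixes U :: "('v \<Rightarrow>\<^sub>0 nat) set"
  assumes U: "\<And>m. m \<in> U \<Longrightarrow> Poly_Mapping.keys m \<subseteq> I"
    and up: "\<And>m t. m \<in> U \<Longrightarrow> Poly_Mapping.keys t \<subseteq> I \<Longrightarrow> t + m \<in> U"
  shows "ideal {f :: ('v, 'k::field) mpoly. Poly_Mapping.keys f \<subseteq> U} (mpoly_ring I)"
proof -
  let ?J = "{f :: ('v, 'k) mpoly. Poly_Mapping.keys f \<subseteq> U}"
  let ?R = "mpoly_ring I :: ('v, 'k) mpoly ring"
  interpret R: cring ?R by (rule cring_mpoly_ring)
  have sub: "?J \<subseteq> carrier ?R" using U by auto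
  have mult: "f * g \<in> ?J" if f: "f \<in> ?J" and g: "g \<in> carrier ?R" for f g
  proof -
    have "m \<in> U" if "m \<in> Poly_Mapping.keys (f * g)" for m
    proof -
      obtain s t where "m = s + t" "s \<in> Poly_Mapping.keys f" "t \<in> Poly_Mapping.keys g"
        using keys_mult[of f g] \<open>m \<in> _\<close> by blast
      then show ?thesis using up[of s t] f g by (auto simp: add.commute)
    qed
    then show ?thesis by blast
  qed
  show ?thesis
  proof (rule idealI)
    show "subgroup ?J (add_monoid ?R)"
    proof (rule R.add.subgroupI)
      fix f g assume f: "f \<in> ?J" and g: "g \<in> ?J"
      show "f \<oplus>\<^bsub>?R\<^esub> g \<in> ?J" using f g Poly_Mapping.keys_add[of f g] by auto
      have "\<ominus>\<^bsub>?R\<^esub> f = - f" using f sub by (intro a_inv_mpoly_ring) auto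
      then show "\<ominus>\<^bsub>?R\<^esub> f \<in> ?J" using f by simp
    next
      have "0 \<in> ?J" by simp
      then show "?J \<noteq> {}" by blast
      show "?J \<subseteq> carrier ?R" by (rule sub)
    qed
  next
    fix f g assume "f \<in> ?J" "g \<in> carrier ?R"
    then show "g \<otimes>\<^bsub>?R\<^esub> f \<in> ?J" "f \<otimes>\<^bsub>?R\<^esub> g \<in> ?J"
      using mult[of f g] by (simp_all add: mult.commute)
  qed (rule R.ring_axioms)
qed

definition monomial_multiples :: "'v set \<Rightarrow> ('v \<Rightarrow>\<^sub>0 nat) set \<Rightarrow> ('v \<Rightarrow>\<^sub>0 nat) set" where
  "monomial_multiples I G = {t + g | t g. Poly_Mapping.keys t \<subseteq> I \<and> g \<in> G}"

lemma keys_add_nat: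
  fixes t m :: "'v \<Rightarrow>\<^sub>0 nat"
  shows "Poly_Mapping.keys (t + m) = Poly_Mapping.keys t \<union> Poly_Mapping.keys m"
  by (auto simp: in_keys_iff lookup_add)

lemma ideal_monomial_multiples:
  assumes "\<And>g. g \<in> G \<Longrightarrow> Poly_Mapping.keys g \<subseteq> I"
  shows "ideal {f :: ('v, 'k::field) mpoly. Poly_Mapping.keys f \<subseteq> monomial_multiples I G}
    (mpoly_ring I)"
proof (rule ideal_keys_subset)
  fix m t :: "'v \<Rightarrow>\<^sub>0 nat" assume m: "m \<in> monomial_multiples I G"
  then obtain s g where sg: "m = s + g" "Poly_Mapping.keys s \<subseteq> I" "g \<in> G"
    by (auto simp: monomial_multiples_def)
  show "Poly_Mapping.keys m \<subseteq> I" using sg assms by (auto simp: keys_add_nat)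
  assume "Poly_Mapping.keys t \<subseteq> I"
  then show "t + m \<in> monomial_multiples I G"
    unfolding monomial_multiples_def using sg
    by (intro CollectI exI[of _ "t + s"] exI[of _ g]) (simp add: keys_add_nat add.assoc)
qed

text \<open>This carries closure of the carrier under \<open>finsum\<close> over to ordinary sums.
  For infinite \<open>A\<close> both sums are 0 by convention.\<close>

lemma finsum_mpoly_ring:
  fixes F :: "'c \<Rightarrow> ('v, 'k::field) mpoly"
  assumes "F \<in> A \<rightarrow> carrier (mpoly_ring I)"
  shows "finsum (mpoly_ring I) F A = (\<Sum>x\<in>A. F x)"
proof -
  interpret R: cring "mpoly_ring I :: ('v, 'k) mpoly ring" by (rule cring_mpoly_ring)
  show ?thesis using assms
    by (induction A rule: infinite_finite_induct) (auto simp: R.finsum_insert Pi_def)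
qed

text \<open>The right-hand side is an ideal containing the generators, which gives one inclusion by
  minimality. For the other, each single term of \<open>f\<close> is a multiple of a generator, and
  \<open>f\<close> is the sum of its terms.\<close>

lemma genideal_monomials:
  assumes G: "\<And>g. g \<in> G \<Longrightarrow> Poly_Mapping.keys g \<subseteq> I"
  shows "Idl\<^bsub>mpoly_ring I\<^esub> ((\<lambda>g. Poly_Mapping.single g 1) ` G) =
    {f :: ('v, 'k::field) mpoly. Poly_Mapping.keys f \<subseteq> monomial_multiples I G}"
    (is "?L = ?J")
proof
  let ?R = "mpoly_ring I :: ('v, 'k) mpoly ring"
  let ?E = "(\<lambda>g. Poly_Mapping.single g 1) ` G :: ('v, 'k) mpoly set"
  interpret R: cring ?R by (rule cring_mpoly_ring)
  have "g \<in> monomial_multiples I G" if "g \<in> G" for g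
    unfolding monomial_multiples_def using that by (auto intro: exI[of _ 0])
  then show "?L \<subseteq> ?J"
    by (intro R.genideal_minimal ideal_monomial_multiples G) auto
  have E: "?E \<subseteq> carrier ?R" using G by force
  interpret L: ideal ?L ?R by (rule R.genideal_ideal[OF E])
  show "?J \<subseteq> ?L"
  proof
    fix f assume f: "f \<in> ?J"
    have "Poly_Mapping.single m (Poly_Mapping.lookup f m) \<in> ?L"
      if m: "m \<in> Poly_Mapping.keys f" for m
    proof -
      obtain t g where tg: "m = t + g" "Poly_Mapping.keys t \<subseteq> I" "g \<in> G"
        using f m by (auto simp: monomial_multiples_def)
      \<comment> \<open>The coefficient is carried by the complementary factor with exponent
        \<open>t\<close>, since the generator itself has coefficient 1.\<close>
      have "Poly_Mapping.single t (Poly_Mapping.lookup f m) \<otimes>\<^bsub>?R\<^esub> Poly_Mapping.single g 1 \<in> ?L"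
        using tg R.genideal_self[OF E] by (intro L.I_l_closed) auto
      then show ?thesis using tg(1) by (simp add: mult_single)
    qed
    then have "(\<Sum>m\<in>A. Poly_Mapping.single m (Poly_Mapping.lookup f m)) \<in> ?L"
      if "A \<subseteq> Poly_Mapping.keys f" for A
      using that L.zero_closed L.a_closed
      by (induction A rule: infinite_finite_induct) auto
    then show "f \<in> ?L"
      using poly_mapping_eq_sum_single[of "Poly_Mapping.keys f" f] by (metis finite_keys order_refl)
  qed
qed

lemma quotient_space_simps [simp]:
  "carrier (quotient_space I J) = carrier (mpoly_ring I Quot J)"
  "zero (quotient_space I J) = zero (mpoly_ring I Quot J)"
  "add (quotient_space I J) = add (mpoly_ring I Quot J)"
  "smult (quotient_space I J) =
    (\<lambda>c X. (J +>\<^bsub>mpoly_ring I\<^esub> const c) \<otimes>\<^bsub>mpoly_ring I Quot J\<^esub> X)"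
  by (simp_all add: quotient_space_def Let_def)

text \<open>The classes of the monomials outside \<open>U\<close> form a basis. They span because
  discarding the terms of \<open>f\<close> with exponent in \<open>U\<close> changes
  \<open>f\<close> by an element of \<open>J\<close>; they are independent because a nonzero
  coefficient outside \<open>U\<close> keeps a polynomial out of \<open>J\<close>.\<close>

lemma dim_quotient_space_monomials:
  fixes U :: "('v \<Rightarrow>\<^sub>0 nat) set" and I :: "'v set"
  defines "J \<equiv> {f :: ('v, 'k::field) mpoly. Poly_Mapping.keys f \<subseteq> U}"
  defines "V \<equiv> quotient_space I J"
  assumes J: "ideal J (mpoly_ring I)"
    and fin: "finite M" and M: "M = {m. Poly_Mapping.keys m \<subseteq> I \<and> m \<notin> U}"
  shows "vectorspace.fin_dim class_ring V \<and> vectorspace.dim class_ring V = card M"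
proof -
  let ?R = "mpoly_ring I :: ('v, 'k) mpoly ring"
  interpret R: cring ?R by (rule cring_mpoly_ring)
  interpret J: ideal J ?R by (rule J)
  interpret Q: cring "?R Quot J" by (rule J.quotient_is_cring) (rule cring_mpoly_ring)
  interpret V: vectorspace class_ring V
    unfolding V_def using J by (rule vectorspace_quotient_space)
  have carrier_V: "carrier V = {J +>\<^bsub>?R\<^esub> f | f. f \<in> carrier ?R}"
    by (auto simp: V_def FactRing_def A_RCOSETS_def' simp del: mpoly_ring_simps)
  have hom_add: "J +>\<^bsub>?R\<^esub> (f + g) = (J +>\<^bsub>?R\<^esub> f) \<oplus>\<^bsub>V\<^esub> (J +>\<^bsub>?R\<^esub> g)"
    and hom_mult: "J +>\<^bsub>?R\<^esub> (f * g) = (J +>\<^bsub>?R\<^esub> f) \<otimes>\<^bsub>?R Quot J\<^esub> (J +>\<^bsub>?R\<^esub> g)"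
    if "f \<in> carrier ?R" "g \<in> carrier ?R" for f g
    using ring_hom_add[OF J.rcos_ring_hom that] ring_hom_mult[OF J.rcos_ring_hom that]
    by (simp_all add: V_def)
  have eq_iff: "J +>\<^bsub>?R\<^esub> f = J +>\<^bsub>?R\<^esub> g \<longleftrightarrow> f - g \<in> J"
    if "f \<in> carrier ?R" "g \<in> carrier ?R" for f g
    using R.quotient_eq_iff_same_a_r_cos[OF J that] a_minus_mpoly_ring[OF that(2)] by metis
  define e where "e m = J +>\<^bsub>?R\<^esub> Poly_Mapping.single m 1" for m
  have mono_closed: "Poly_Mapping.single m c \<in> carrier ?R" if "m \<in> M" for m c
    using that by (auto simp: M)
  have sum_closed: "(\<Sum>m\<in>A. Poly_Mapping.single m (c m)) \<in> carrier ?R" if "A \<subseteq> M" for A c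
  proof -
    have F: "(\<lambda>m. Poly_Mapping.single m (c m)) \<in> A \<rightarrow> carrier ?R" using that mono_closed by blast
    then show ?thesis unfolding finsum_mpoly_ring[OF F, symmetric] by (rule R.finsum_closed)
  qed
  have e_closed: "e m \<in> carrier V" if "m \<in> M" for m
    unfolding e_def carrier_V using mono_closed[OF that] by blast
  have smult_e: "c \<odot>\<^bsub>V\<^esub> e m = J +>\<^bsub>?R\<^esub> Poly_Mapping.single m c" if "m \<in> M" for m c
    using hom_mult[of "const c" "Poly_Mapping.single m 1"] mono_closed[OF that, of 1]
    by (simp add: e_def V_def const_def mult_single)
  have inj: "inj_on e M"
  proof (rule inj_onI, rule ccontr)
    fix m m' assume m: "m \<in> M" "m' \<in> M" and "e m = e m'" and ne: "m \<noteq> m'"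
    then have "Poly_Mapping.single m 1 - Poly_Mapping.single m' 1 \<in> J"
      using eq_iff[OF mono_closed mono_closed, OF m] by (simp add: e_def)
    moreover have "m \<in> Poly_Mapping.keys (Poly_Mapping.single m 1 - Poly_Mapping.single m' 1 :: ('v, 'k) mpoly)"
      using ne by (simp add: in_keys_iff lookup_minus lookup_single when_def)
    ultimately show False using m(1) by (auto simp: J_def M)
  qed
  \<comment> \<open>Linear combinations in the quotient become classes of ordinary polynomials.
    Coefficients of \<open>lincomb\<close> are indexed by vectors, hence \<open>a (e m)\<close>;
    injectivity of \<open>e\<close> keeps the summands apart.\<close>
  have lincomb: "V.lincomb a (e ` A) =
      J +>\<^bsub>?R\<^esub> (\<Sum>m\<in>A. Poly_Mapping.single m (a (e m)))" if "A \<subseteq> M" for a A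
  proof -
    have "finite A" using that fin by (rule finite_subset)
    then show ?thesis using that
    proof (induction A)
      case empty
      have "J +>\<^bsub>?R\<^esub> 0 = zero V"
        using ring_hom_zero[OF J.rcos_ring_hom R.ring_axioms Q.ring_axioms] by (simp add: V_def)
      then show ?case by (simp add: V.lincomb_def)
    next
      case (insert m A)
      have m: "m \<in> M" and A: "A \<subseteq> M" using insert.prems by auto
      have "e m \<notin> e ` A" using inj insert.hyps(2) m A by (auto dest: inj_onD)
      then have "V.lincomb a (e ` insert m A) = a (e m) \<odot>\<^bsub>V\<^esub> e m \<oplus>\<^bsub>V\<^esub> V.lincomb a (e ` A)"
        unfolding V.lincomb_def image_insert using insert.hyps(1) e_closed m A
        by (subst V.finsum_insert) auto
      also have "\<dots> = J +>\<^bsub>?R\<^esub> (\<Sum>m\<in>insert m A. Poly_Mapping.single m (a (e m)))"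
        unfolding insert.IH[OF A] smult_e[OF m] sum.insert[OF insert.hyps]
        using hom_add[OF mono_closed[OF m] sum_closed[OF A]] by simp
      finally show ?case .
    qed
  qed
  have "\<not> V.lin_dep (e ` M)"
  proof
    assume "V.lin_dep (e ` M)"
    then obtain B a v where B: "B \<subseteq> e ` M" "V.lincomb a B = zero V" "v \<in> B" "a v \<noteq> 0"
      unfolding V.lin_dep_def by auto
    then obtain A where A: "A \<subseteq> M" "B = e ` A" by (meson subset_image_iff)
    then obtain m where m: "m \<in> A" "v = e m" using B(3) by blast
    have "finite A" using A(1) fin by (rule finite_subset)
    let ?f = "\<Sum>m\<in>A. Poly_Mapping.single m (a (e m))"
    have zero: "J +>\<^bsub>?R\<^esub> 0 = zero V"
      using ring_hom_zero[OF J.rcos_ring_hom R.ring_axioms Q.ring_axioms] by (simp add: V_def)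
    then have "J +>\<^bsub>?R\<^esub> ?f = J +>\<^bsub>?R\<^esub> 0" using B(2) lincomb[OF A(1), of a] A(2) by simp
    then have "?f \<in> J" using eq_iff[OF sum_closed[OF A(1)], of 0 "\<lambda>m. a (e m)"] by simp
    moreover have "Poly_Mapping.lookup ?f m = a v"
      using m \<open>finite A\<close> by (simp add: lookup_sum lookup_single when_def)
    then have "m \<in> Poly_Mapping.keys ?f" using B(4) by (simp add: in_keys_iff)
    ultimately show False using m(1) A(1) by (auto simp: J_def M)
  qed
  moreover have eM: "e ` M \<subseteq> carrier V" using e_closed by blast
  moreover have span: "V.span (e ` M) = carrier V"
  proof
    show "V.span (e ` M) \<subseteq> carrier V" using V.span_is_subset2[OF eM] .
    show "carrier V \<subseteq> V.span (e ` M)"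
    proof
      fix v assume "v \<in> carrier V"
      then obtain f where f: "f \<in> carrier ?R" "v = J +>\<^bsub>?R\<^esub> f" by (auto simp: carrier_V)
      \<comment> \<open>\<open>inv_into\<close> recovers the monomial from its class, so that
        \<open>a (e m)\<close> is the coefficient of \<open>f\<close> at \<open>m\<close>.\<close>
      define a where "a w = Poly_Mapping.lookup f (inv_into M e w)" for w
      let ?g = "\<Sum>m\<in>M. Poly_Mapping.single m (a (e m))"
      have lookup_g: "Poly_Mapping.lookup ?g m = (if m \<in> M then Poly_Mapping.lookup f m else 0)" for m
        using fin by (simp add: lookup_sum lookup_single when_def a_def inj)
      have "m \<in> U" if "m \<in> Poly_Mapping.keys (f - ?g)" for m
        using that f(1) lookup_g[of m] by (fastforce simp: in_keys_iff lookup_minus M split: if_splits)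
      then have "f - ?g \<in> J" by (auto simp: J_def)
      then have "v = V.lincomb a (e ` M)"
        using eq_iff[OF f(1) sum_closed[of M "\<lambda>m. a (e m)"]] f(2) lincomb[of M a] by simp
      then show "v \<in> V.span (e ` M)"
        unfolding V.span_def using fin
        by (intro CollectI exI[of _ a] exI[of _ "e ` M"]) auto
    qed
  qed
  ultimately have "V.basis (e ` M)" by (simp add: V.basis_def)
  then have "V.dim = card M" using V.dim_basis[of "e ` M"] fin by (simp add: card_image[OF inj])
  moreover have "V.fin_dim" unfolding V.fin_dim_def using fin eM span by blast
  ultimately show ?thesis by blast
qed

section \<open>The ideal of a matrix\<close>

lemma var_power: "var p ^ k = (Poly_Mapping.single (Poly_Mapping.single p k) 1 :: ('v, 'k::field) mpoly)"
  by (induction k) (simp_all add: var_def mult_single flip: single_add)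

definition J_monomials :: "'v set \<Rightarrow> ('v \<Rightarrow> 'v \<Rightarrow> nat) \<Rightarrow> ('v \<Rightarrow>\<^sub>0 nat) set" where
  "J_monomials I h = {Poly_Mapping.single p (h p p) | p. p \<in> I} \<union>
     {Poly_Mapping.single p (h p p - h p q) + Poly_Mapping.single q (h q q - h p q) | p q.
        p \<in> I \<and> q \<in> I \<and> p \<noteq> q}"

lemma keys_J_monomials: "g \<in> J_monomials I h \<Longrightarrow> Poly_Mapping.keys g \<subseteq> I"
  by (auto simp: J_monomials_def keys_add_nat split: if_splits)

lemma ideal_J_eq:
  "ideal_J I h =
    {f :: ('v, 'k::field) mpoly. Poly_Mapping.keys f \<subseteq> monomial_multiples I (J_monomials I h)}"
proof -
  let ?mono = "\<lambda>g. Poly_Mapping.single g 1 :: ('v, 'k) mpoly"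
  have eq: "{var p ^ h p p | p. p \<in> I} \<union>
      {var p ^ (h p p - h p q) * var q ^ (h q q - h p q) | p q. p \<in> I \<and> q \<in> I \<and> p \<noteq> q} =
      ?mono ` J_monomials I h"
    unfolding J_monomials_def var_power mult_single by (auto simp: image_iff)
  show ?thesis
    unfolding ideal_J_def eq by (rule genideal_monomials) (rule keys_J_monomials)
qed

lemma in_monomial_multiples_iff:
  assumes "\<And>g. g \<in> G \<Longrightarrow> Poly_Mapping.keys g \<subseteq> I"
  shows "m \<in> monomial_multiples I G \<longleftrightarrow> Poly_Mapping.keys m \<subseteq> I \<and>
    (\<exists>g\<in>G. \<forall>p. Poly_Mapping.lookup g p \<le> Poly_Mapping.lookup m p)"
proof
  assume "m \<in> monomial_multiples I G"
  then obtain t g where "m = t + g" "Poly_Mapping.keys t \<subseteq> I" "g \<in> G"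
    by (auto simp: monomial_multiples_def)
  then show "Poly_Mapping.keys m \<subseteq> I \<and>
      (\<exists>g\<in>G. \<forall>p. Poly_Mapping.lookup g p \<le> Poly_Mapping.lookup m p)"
    using assms[of g] by (auto simp: keys_add_nat lookup_add intro!: bexI[of _ g])
next
  assume m: "Poly_Mapping.keys m \<subseteq> I \<and>
      (\<exists>g\<in>G. \<forall>p. Poly_Mapping.lookup g p \<le> Poly_Mapping.lookup m p)"
  then obtain g where g: "g \<in> G" "\<And>p. Poly_Mapping.lookup g p \<le> Poly_Mapping.lookup m p" by blast
  \<comment> \<open>The cofactor is the truncated difference, which is genuine because
    \<open>g\<close> is pointwise below \<open>m\<close>.\<close>
  have "m = (m - g) + g" by (rule poly_mapping_eqI) (simp add: lookup_add lookup_minus g(2))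
  moreover have "Poly_Mapping.keys (m - g) \<subseteq> Poly_Mapping.keys m"
    by (auto simp: in_keys_iff lookup_minus)
  ultimately show "m \<in> monomial_multiples I G"
    unfolding monomial_multiples_def using m g(1) by blast
qed

lemma in_multiples_J_monomials_iff:
  "m \<in> monomial_multiples I (J_monomials I h) \<longleftrightarrow> Poly_Mapping.keys m \<subseteq> I \<and>
    ((\<exists>p\<in>I. h p p \<le> Poly_Mapping.lookup m p) \<or>
     (\<exists>p\<in>I. \<exists>q\<in>I. p \<noteq> q \<and> h p p - h p q \<le> Poly_Mapping.lookup m p \<and>
        h q q - h p q \<le> Poly_Mapping.lookup m q))"
proof -
  have one: "(\<forall>s. Poly_Mapping.lookup (Poly_Mapping.single p k) s \<le> Poly_Mapping.lookup m s) \<longleftrightarrow>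
      k \<le> Poly_Mapping.lookup m p" for p k
    by (auto simp: lookup_single when_def)
  \<comment> \<open>Distinctness of \<open>p\<close> and \<open>q\<close> keeps the two exponents
    from adding up in one variable.\<close>
  have two: "(\<forall>s. Poly_Mapping.lookup (Poly_Mapping.single p k + Poly_Mapping.single q l) s
        \<le> Poly_Mapping.lookup m s) \<longleftrightarrow>
      k \<le> Poly_Mapping.lookup m p \<and> l \<le> Poly_Mapping.lookup m q" if "p \<noteq> q" for p q k l
  proof -
    have "Poly_Mapping.lookup (Poly_Mapping.single p k + Poly_Mapping.single q l) s =
        (if s = p then k else if s = q then l else 0)" for s
      using that by (simp add: lookup_add lookup_single when_def)
    then show ?thesis using that by (metis zero_le)
  qed
  have bex: "(\<exists>g\<in>{f p | p. p \<in> I} \<union> {k p q | p q. p \<in> I \<and> q \<in> I \<and> p \<noteq> q}. P g) \<longleftrightarrow>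
      (\<exists>p\<in>I. P (f p)) \<or> (\<exists>p\<in>I. \<exists>q\<in>I. p \<noteq> q \<and> P (k p q))"
    for P :: "('a \<Rightarrow>\<^sub>0 nat) \<Rightarrow> bool" and f k by blast
  have "(\<exists>g\<in>J_monomials I h. \<forall>s. Poly_Mapping.lookup g s \<le> Poly_Mapping.lookup m s) \<longleftrightarrow>
    (\<exists>p\<in>I. \<forall>s. Poly_Mapping.lookup (Poly_Mapping.single p (h p p)) s \<le> Poly_Mapping.lookup m s) \<or>
    (\<exists>p\<in>I. \<exists>q\<in>I. p \<noteq> q \<and> (\<forall>s. Poly_Mapping.lookup (Poly_Mapping.single p (h p p - h p q) +
       Poly_Mapping.single q (h q q - h p q)) s \<le> Poly_Mapping.lookup m s))"
    unfolding J_monomials_def by (rule bex)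
  also have "\<dots> \<longleftrightarrow> (\<exists>p\<in>I. h p p \<le> Poly_Mapping.lookup m p) \<or>
     (\<exists>p\<in>I. \<exists>q\<in>I. p \<noteq> q \<and> h p p - h p q \<le> Poly_Mapping.lookup m p \<and>
        h q q - h p q \<le> Poly_Mapping.lookup m q)"
    by (simp only: one two not_False_eq_True cong: conj_cong)
  finally show ?thesis
    using in_monomial_multiples_iff[of "J_monomials I h" I m] keys_J_monomials by metis
qed

text \<open>For exponents below \<open>h p p\<close>, the reflection to
  \<open>a p = h p p - 1 - m p\<close> turns \<open>m p < h p p - h p q\<close> into
  \<open>h p q \<le> a p\<close>. Avoiding a mixed generator thus becomes the bound on
  \<open>max (a p) (a q)\<close>.\<close>

lemma standard_monomials_bij_admissible:
  assumes fin: "finite I" and dom: "\<And>p q. p \<in> I \<Longrightarrow> q \<in> I \<Longrightarrow> h p q \<le> h p p \<and> h p q \<le> h q q"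
  shows "bij_betw (\<lambda>m. \<lambda>p\<in>I. h p p - 1 - Poly_Mapping.lookup m p)
    {m. Poly_Mapping.keys m \<subseteq> I \<and> m \<notin> monomial_multiples I (J_monomials I h)} (admissible h I)"
    (is "bij_betw ?F ?M _")
proof (rule bij_betw_byWitness)
  \<comment> \<open>The inverse is the same reflection, extended by 0 outside \<open>I\<close>;
    finiteness of \<open>I\<close> gives finite support.\<close>
  let ?G = "\<lambda>a. Abs_poly_mapping (\<lambda>p. if p \<in> I then h p p - 1 - a p else 0)"
  have lookup_G: "Poly_Mapping.lookup (?G a) p = (if p \<in> I then h p p - 1 - a p else 0)" for a p
    using fin by (subst Abs_poly_mapping_inverse) auto
  have M: "m \<in> ?M \<longleftrightarrow> Poly_Mapping.keys m \<subseteq> I \<and> (\<forall>p\<in>I. Poly_Mapping.lookup m p < h p p) \<and>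
     (\<forall>p\<in>I. \<forall>q\<in>I. p \<noteq> q \<longrightarrow> Poly_Mapping.lookup m p < h p p - h p q \<or>
        Poly_Mapping.lookup m q < h q q - h p q)" for m
    by (auto simp: in_multiples_J_monomials_iff not_le)
  show "\<forall>m\<in>?M. ?G (?F m) = m"
  proof
    fix m assume m: "m \<in> ?M"
    show "?G (?F m) = m"
    proof (rule poly_mapping_eqI)
      fix p
      show "Poly_Mapping.lookup (?G (?F m)) p = Poly_Mapping.lookup m p"
      proof (cases "p \<in> I")
        case True
        then have "Poly_Mapping.lookup m p < h p p" using m unfolding M by blast
        then show ?thesis using True unfolding lookup_G by simp
      next
        case False
        then have "p \<notin> Poly_Mapping.keys m" using m by blast
        then show ?thesis using False unfolding lookup_G by (simp add: in_keys_iff)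
      qed
    qed
  qed
  show "\<forall>a\<in>admissible h I. ?F (?G a) = a"
  proof
    fix a assume a: "a \<in> admissible h I"
    have "?F (?G a) p = a p" for p
    proof (cases "p \<in> I")
      case True
      then have "a p < h p p" using a by (auto simp: admissible_def)
      then show ?thesis using True by (simp add: lookup_G)
    next
      case False
      then show ?thesis using a by (auto simp: admissible_def PiE_def extensional_def)
    qed
    then show "?F (?G a) = a" by blast
  qed
  show "?F ` ?M \<subseteq> admissible h I"
  proof
    fix a assume "a \<in> ?F ` ?M"
    then obtain m where m: "m \<in> ?M" and a: "a = ?F m" by blast
    have lt: "Poly_Mapping.lookup m p < h p p" if "p \<in> I" for p
      using m that unfolding M by blast
    have "h p q \<le> max (a p) (a q)" if pq: "p \<in> I" "q \<in> I" "p \<noteq> q" for p q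
    proof -
      have "Poly_Mapping.lookup m p < h p p - h p q \<or> Poly_Mapping.lookup m q < h q q - h p q"
        using m pq unfolding M by blast
      then show ?thesis using pq by (auto simp: a)
    qed
    moreover have "a \<in> PiE I (\<lambda>p. {..<h p p})" using lt by (fastforce simp: a)
    ultimately show "a \<in> admissible h I" by (simp add: admissible_def)
  qed
  show "?G ` admissible h I \<subseteq> ?M"
  proof
    fix m assume "m \<in> ?G ` admissible h I"
    then obtain a where a: "a \<in> admissible h I" and m: "m = ?G a" by blast
    have lt: "a p < h p p" if "p \<in> I" for p using a that by (auto simp: admissible_def)
    have "Poly_Mapping.lookup m p < h p p - h p q \<or> Poly_Mapping.lookup m q < h q q - h p q"
      if pq: "p \<in> I" "q \<in> I" "p \<noteq> q" for p q
    proof -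
      have "h p q \<le> a p \<or> h p q \<le> a q" using a pq by (auto simp: admissible_def le_max_iff_disj)
      then show ?thesis
        using lt[OF pq(1)] lt[OF pq(2)] pq unfolding m lookup_G by auto
    qed
    moreover have "Poly_Mapping.lookup m p < h p p" if "p \<in> I" for p
      using lt[OF that] that unfolding m lookup_G by simp
    moreover have "Poly_Mapping.keys m \<subseteq> I" unfolding m by (auto simp: in_keys_iff lookup_G split: if_splits)
    ultimately show "m \<in> ?M" unfolding M by blast
  qed
qed

lemma dim_quotient_ideal_J:
  fixes I :: "'v set" and h :: "'v \<Rightarrow> 'v \<Rightarrow> nat"
  defines "V \<equiv> quotient_space I (ideal_J I h :: ('v, 'k::field) mpoly set)"
  assumes fin: "finite I" and dom: "\<And>p q. p \<in> I \<Longrightarrow> q \<in> I \<Longrightarrow> h p q \<le> h p p \<and> h p q \<le> h q q"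
  shows "vectorspace.fin_dim class_ring V \<and>
    vectorspace.dim class_ring V = card (admissible h I)"
proof -
  define M where "M = {m. Poly_Mapping.keys m \<subseteq> I \<and> m \<notin> monomial_multiples I (J_monomials I h)}"
  have bij: "bij_betw (\<lambda>m. \<lambda>p\<in>I. h p p - 1 - Poly_Mapping.lookup m p) M (admissible h I)"
    unfolding M_def using assms(2,3) by (rule standard_monomials_bij_admissible)
  have "finite M" using bij_betw_finite[OF bij] finite_admissible[OF fin] by blast
  then have "vectorspace.fin_dim class_ring V \<and> vectorspace.dim class_ring V = card M"
    unfolding V_def ideal_J_eq using M_def
    by (intro dim_quotient_space_monomials ideal_monomial_multiples keys_J_monomials)
  then show ?thesis using bij_betw_same_card[OF bij] by simp
qed

section \<open>The block matrix of the theorem\<close>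

text \<open>Entries between different blocks depend on the larger block number only and do not
  increase with it, while \<open>b i\<close> dominates every such entry in the rows of block
  \<open>i\<close>. The proof distinguishes which of the three blocks coincide.\<close>

lemma ultrametric_on_H_entry:
  assumes \<alpha>: "\<And>i j. 1 \<le> i \<Longrightarrow> i \<le> r \<Longrightarrow> 1 \<le> j \<Longrightarrow> j \<le> n i \<Longrightarrow> \<alpha> i j \<ge> b i"
    and b1: "r \<ge> 2 \<Longrightarrow> b 1 \<ge> d 1"
    and b: "\<And>i. 2 \<le> i \<Longrightarrow> i \<le> r \<Longrightarrow> b i \<ge> d (i - 1)"
    and d: "\<And>i. 1 \<le> i \<Longrightarrow> i + 2 \<le> r \<Longrightarrow> d i \<ge> d (i + 1)"
  shows "ultrametric_on (index_set r n) (H_entry \<alpha> b d)"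
proof -
  have d_mono: "d j \<le> d i" if "1 \<le> i" "i \<le> j" "j < r" for i j
    using that(2,3)
  proof (induction j rule: dec_induct)
    case (step k)
    then show ?case using d[of k] that(1) by simp
  qed simp
  have d_le_b: "d (max i j - 1) \<le> b i" if "1 \<le> i" "i \<le> r" "1 \<le> j" "j \<le> r" "i \<noteq> j" for i j
  proof (cases "i = 1")
    case True
    then have "d (j - 1) \<le> d 1" "d 1 \<le> b 1" using that b1 by (intro d_mono, simp_all)
    then show ?thesis using True that by (simp add: max_def)
  next
    case False
    then have "d (max i j - 1) \<le> d (i - 1)" using that by (intro d_mono) auto
    then show ?thesis using b[of i] that False by simp
  qed
  have "min (H_entry \<alpha> b d (i, u) (j, v)) (H_entry \<alpha> b d (j, v) (k, w)) \<le> H_entry \<alpha> b d (i, u) (k, w)"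
    if "(i, u) \<in> index_set r n" "(j, v) \<in> index_set r n" "(k, w) \<in> index_set r n"
    for i u j v k w
  proof -
    have i: "1 \<le> i" "i \<le> r" "1 \<le> u" "u \<le> n i" and j: "1 \<le> j" "j \<le> r" and k: "1 \<le> k" "k \<le> r"
      using that by (auto simp: index_set_def)
    consider "i = k" "j = i" | "i = k" "j \<noteq> i" | "i \<noteq> k" "j = i" | "i \<noteq> k" "j = k"
      | "i \<noteq> k" "j \<noteq> i" "j \<noteq> k" by blast
    then show ?thesis
    proof cases
      case 1
      \<comment> \<open>Within one block, some entry on the left is \<open>b i\<close> unless
        \<open>u = v = w\<close>.\<close>
      then show ?thesis using \<alpha>[OF i] by auto
    next
      case 2
      then show ?thesis using \<alpha>[OF i] d_le_b[OF i(1,2) j] by auto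
    next
      case 3
      \<comment> \<open>Here the second entry on the left equals the right-hand side; in the next
        case the first one does.\<close>
      then show ?thesis by simp
    next
      case 4
      then show ?thesis by simp
    next
      case 5
      \<comment> \<open>The larger of \<open>i\<close> and \<open>k\<close> also occurs in one of
        the other two maxima. As \<open>i \<noteq> k\<close>, the index \<open>max i k - 1\<close>
        is at least 1, where \<open>d_mono\<close> applies.\<close>
      have "max i k - 1 \<le> max i j - 1 \<or> max i k - 1 \<le> max j k - 1" by (auto simp: max_def)
      then have "d (max i j - 1) \<le> d (max i k - 1) \<or> d (max j k - 1) \<le> d (max i k - 1)"
        using d_mono[of "max i k - 1" "max i j - 1"] d_mono[of "max i k - 1" "max j k - 1"] 5 i j k
        by (auto simp: max_def split: if_splits)
      then show ?thesis using 5 by (simp add: min_le_iff_disj)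
    qed
  qed
  moreover have "H_entry \<alpha> b d p q = H_entry \<alpha> b d q p" for p q
    by (cases p; cases q) (auto simp: max.commute)
  ultimately show ?thesis unfolding ultrametric_on_def by (metis surj_pair)
qed

theorem theorem2p3:
  fixes r :: nat and n :: "nat \<Rightarrow> nat"
    and \<alpha> :: "nat \<Rightarrow> nat \<Rightarrow> nat" and b d :: "nat \<Rightarrow> nat"
  assumes "r \<ge> 1"
    and "\<And>i. 1 \<le> i \<Longrightarrow> i \<le> r \<Longrightarrow> n i \<ge> 1"
    and "\<And>i j. 1 \<le> i \<Longrightarrow> i \<le> r \<Longrightarrow> 1 \<le> j \<Longrightarrow> j \<le> n i \<Longrightarrow> \<alpha> i j \<ge> b i"
    and "r \<ge> 2 \<Longrightarrow> b 1 \<ge> d 1"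
    and "\<And>i. 2 \<le> i \<Longrightarrow> i \<le> r \<Longrightarrow> b i \<ge> d (i - 1)"
    and "\<And>i. 1 \<le> i \<Longrightarrow> i + 2 \<le> r \<Longrightarrow> d i \<ge> d (i + 1)"
  shows "let I = index_set r n;
             V = quotient_space I (ideal_J I (H_entry \<alpha> b d) :: (nat \<times> nat, 'k::field) mpoly set)
         in vectorspace.fin_dim class_ring V \<and>
            int (vectorspace.dim class_ring V) = det (H_matrix r n \<alpha> b d)"
proof -
  let ?I = "index_set r n" and ?h = "H_entry \<alpha> b d"
  have u: "ultrametric_on ?I ?h" using assms(3-6) by (rule ultrametric_on_H_entry)
  have "?h p q \<le> ?h p p \<and> ?h p q \<le> ?h q q" if "p \<in> ?I" "q \<in> ?I" for p q
    using ultrametric_onD(3)[OF u that] ultrametric_onD(3)[OF u that(2,1)]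
      ultrametric_onD(1)[OF u that] by simp
  moreover have "finite ?I" by (metis List.finite_set set_index_list)
  moreover have "H_matrix r n \<alpha> b d = list_mat ?h (index_list r n)"
    by (simp add: H_matrix_def list_mat_def length_index_list)
  then have "det (H_matrix r n \<alpha> b d) = int (card (admissible ?h ?I))"
    using det_ultrametric_eq_card_admissible[OF distinct_index_list, of r n ?h] u
    by (simp add: set_index_list)
  ultimately show ?thesis
    using dim_quotient_ideal_J[of ?I ?h] by (simp add: Let_def)
qed

end
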